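(* Let $A$ be a commutative ring and $I$ an ideal of $A$. Then $[I:\operatorname{Ann}(I)]=A$, and if $J$ is an ideal of $A$ satisfying $[I:J]=A$, then $\operatorname{Ann}(I)\subseteq J$.
   Context: All rings are commutative with identity. For ideals $I,J$ of a ring $A$, $\operatorname{Ann}(I)=\{a\in A\mid aI=0\}$ and $(J:I)=\{a\in A\mid aI\subseteq J\}$. The coproduct of $I$ and $J$ is the ideal $[I:J]:=(J:\operatorname{Ann}(I))=\{a\in A\mid a\operatorname{Ann}(I)\subseteq J\}$. *)

theory Defs
  imports "HOL-Algebra.Ideal"
begin

definition annihilator :: "('a, 'b) ring_scheme \<Rightarrow> 'a set \<Rightarrow> 'a set"
  where "annihilator R I = {a \<in> carrier R. \<forall>x\<in>I. a \<otimes>\<^bsub>R\<^esub> x = \<zero>\<^bsub>R\<^esub>}"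

(* ideal_quotient R J I is the colon ideal (J : I); not the quotient ring R Quot I *)
definition ideal_quotient :: "('a, 'b) ring_scheme \<Rightarrow> 'a set \<Rightarrow> 'a set \<Rightarrow> 'a set"
  where "ideal_quotient R J I = {a \<in> carrier R. \<forall>x\<in>I. a \<otimes>\<^bsub>R\<^esub> x \<in> J}"

(* [I : J] = (J : Ann I); note that the order of the two arguments is swapped *)
definition ideal_coproduct :: "('a, 'b) ring_scheme \<Rightarrow> 'a set \<Rightarrow> 'a set \<Rightarrow> 'a set"
  where "ideal_coproduct R I J = ideal_quotient R J (annihilator R I)"

lemma (in cring) ideal_quotient_ideal:
  assumes "ideal J R" and "I \<subseteq> carrier R"
  shows "ideal (ideal_quotient R J I) R"
proof -
  interpret J: ideal J R by fact
  have minus: "\<ominus> a \<otimes> x \<in> J" if "a \<in> carrier R" "x \<in> carrier R" "a \<otimes> x \<in> J" for a x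
    using that by (simp add: l_minus)
  show ?thesis
  proof (rule idealI)
    show "ring R" by (rule ring_axioms)
    show "subgroup (ideal_quotient R J I) (add_monoid R)"
      using assms(2) minus
      by unfold_locales
        (auto simp: ideal_quotient_def subset_iff l_distr a_inv_def[symmetric])
  next
    fix a x assume a: "a \<in> ideal_quotient R J I" and x: "x \<in> carrier R"
    show "x \<otimes> a \<in> ideal_quotient R J I"
      using a x assms(2) J.I_l_closed by (auto simp: ideal_quotient_def subset_iff m_assoc)
    then show "a \<otimes> x \<in> ideal_quotient R J I"
      using a x by (simp add: ideal_quotient_def m_comm)
  qed
qed

lemma (in cring) annihilator_ideal:
  assumes "ideal I R"
  shows "ideal (annihilator R I) R"
proof -
  have "annihilator R I = ideal_quotient R {\<zero>} I"
    by (simp add: annihilator_def ideal_quotient_def)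
  moreover have "I \<subseteq> carrier R"
    using additive_subgroup.a_subset[OF ideal.axioms(1)[OF assms]] .
  ultimately show ?thesis
    using ideal_quotient_ideal[OF zeroideal] by simp
qed

lemma (in cring) ideal_coproduct_ideal:
  assumes "ideal J R"
  shows "ideal (ideal_coproduct R I J) R"
  unfolding ideal_coproduct_def
  using assms by (rule ideal_quotient_ideal) (auto simp: annihilator_def)

end

theory Submission
  imports Defs
begin

text \<open>The coproduct is a colon ideal by \<open>annihilator R I\<close>, and an ideal is the
  whole ring as soon as it contains \<open>\<one>\<close>. Since
  \<open>\<one> \<otimes> x = x\<close>, that membership says precisely that the annihilator lies in
  \<open>J\<close>. Both claims of the theorem are read off from this equivalence.\<close>

lemma (in cring) ideal_coproduct_eq_carrier_iff:
  assumes "ideal J R"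
  shows "ideal_coproduct R I J = carrier R \<longleftrightarrow> annihilator R I \<subseteq> J"
proof
  assume "ideal_coproduct R I J = carrier R"
  then have "\<one> \<in> ideal_coproduct R I J"
    by simp
  then show "annihilator R I \<subseteq> J"
    by (auto simp: ideal_coproduct_def ideal_quotient_def annihilator_def)
next
  assume "annihilator R I \<subseteq> J"
  \<comment> \<open>\<open>J\<close> absorbs multiplication, so every ring element carries the
    annihilator into \<open>J\<close>.\<close>
  then show "ideal_coproduct R I J = carrier R"
    using ideal.I_l_closed[OF assms]
    by (auto simp: ideal_coproduct_def ideal_quotient_def)
qed

theorem proposition8:
  fixes A :: "('a, 'b) ring_scheme" and I :: "'a set"
  assumes "cring A" and "ideal I A"
  shows "ideal_coproduct A I (annihilator A I) = carrier A \<and>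
    (\<forall>J. ideal J A \<longrightarrow> ideal_coproduct A I J = carrier A \<longrightarrow> annihilator A I \<subseteq> J)"
proof -
  interpret cring A by fact
  \<comment> \<open>The first claim is the case where \<open>J\<close> is the annihilator itself: it
    is an ideal, and the inclusion becomes reflexivity.\<close>
  show ?thesis
    using annihilator_ideal[OF assms(2)] by (simp add: ideal_coproduct_eq_carrier_iff)
qed

end
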